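(* Let $\mathcal{X}=\{\mathbf{x}_1,\ldots,\mathbf{x}_n\}\subset\mathbb{R}^d$, $N=\{1,\ldots,n\}$, $P=\{1,\ldots,p\}$ with $1\le p<n$, $C>0$, let $\Phi:\mathbb{R}^d\to\mathbb{R}^{d'}$ be a mapping and let $\mathcal{K}:\mathbb{R}^d\times\mathbb{R}^d\to\mathbb{R}$ be the kernel $\mathcal{K}(\mathbf{x},\mathbf{y})=\Phi(\mathbf{x})^T\Phi(\mathbf{y})$. Consider the two optimization problems $$(F^{\Phi}_{MSVDD})\quad \min\ \sum_{j\in P}R_j+\sum_{i\in N}C\xi_i$$ subject to $$\|\Phi(\mathbf{x}_i)-\mathbf{c}_j\|_2^2\le R_j+\xi_i+\Delta_i(1-z_{ij})\ \ \forall i\in N,\,j\in P;\qquad \sum_{j\in P}z_{ij}=1\ \ \forall i\in N;\qquad \sum_{i\in N}Cz_{ij}\ge 1\ \ \forall j\in P;$$ $$\xi_i\ge 0\ \ \forall i\in N;\qquad \mathbf{c}_j\in\mathbb{R}^{d'}\ \ \forall j\in P;\qquad R_j\in\mathbb{R}\ \ \forall j\in P;\qquad z_{ij}\in\{0,1\}\ \ \forall i\in N,\,j\in P,$$ and $$(F^{\mathcal{K}}_{MSVDD})\quad \min\ \sum_{j\in P}R_j+\sum_{i\in N}C\xi_i$$ subject to $$\mathcal{K}(\mathbf{x}_i,\mathbf{x}_i)-2\sum_{k\in N}\alpha_{kj}\mathcal{K}(\mathbf{x}_i,\mathbf{x}_k)+\sum_{k\in N}\sum_{l\in N}\alpha_{kj}\alpha_{lj}\mathcal{K}(\mathbf{x}_k,\mathbf{x}_l)\le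 R_j+\xi_i+\Delta_i(1-z_{ij})\ \ \forall i\in N,\,j\in P;$$ $$0\le\alpha_{ij}\le Cz_{ij}\ \ \forall i\in N,\,j\in P;\qquad \sum_{i\in N}\alpha_{ij}=1\ \ \forall j\in P;\qquad \sum_{j\in P}z_{ij}=1\ \ \forall i\in N;$$ $$\xi_i\ge 0\ \ \forall i\in N;\qquad R_j\in\mathbb{R}\ \ \forall j\in P;\qquad z_{ij}\in\{0,1\}\ \ \forall i\in N,\,j\in P,$$ where the $\Delta_i$ are large enough constants. Then $(F^{\Phi}_{MSVDD})$ and $(F^{\mathcal{K}}_{MSVDD})$ are equivalent, in the sense that both have the same optimal value and an optimal solution of either one can be built from an optimal solution of the other. Moreover, in $(F^{\mathcal{K}}_{MSVDD})$ the constant $\Delta_i$ can be set, for all $i\in N$, as $$\Delta_i:=\mathcal{K}(\mathbf{x}_i,\mathbf{x}_i)-2\sum_{k\in N}\pi_{ik}\mathcal{K}(\mathbf{x}_i,\mathbf{x}_k)+\sum_{k\in N}\sum_{l\in N}(C-\pi_{kl})^2\mathcal{K}(\mathbf{x}_k,\mathbf{x}_l),$$ where $\pi_{ik}=C$ if $\mathcal{K}(\mathbf{x}_i,\mathbf{x}_k)<0$ and $\pi_{ik}=0$ otherwise.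
   Context: $\mathcal{X}$ is a finite training dataset with index set $N$; $P$ indexes the $p$ hyperspheres; $C$ is a penalty parameter. The variables are: $R_j$ (squared radius of hypersphere $j$), $\mathbf{c}_j$ (center of hypersphere $j$ in the transformed space), $\xi_i$ (error of observation $i$), $z_{ij}$ (equal to 1 if observation $i$ is allocated to hypersphere $j$, 0 otherwise), and $\alpha_{ij}$. The kernel $\mathcal{K}$ is assumed to satisfy Mercer's condition and to represent the inner product $\mathcal{K}(\mathbf{x},\mathbf{y})=\Phi(\mathbf{x})^T\Phi(\mathbf{y})$ for all $\mathbf{x},\mathbf{y}\in\mathbb{R}^d$. The constants $\Delta_i$ are "big-M" constants: "large enough" means that the constraint in which $\Delta_i(1-z_{ij})$ appears is effectively imposed only when $z_{ij}=1$ (it linearizes the requirement that the squared distance from $\Phi(\mathbf{x}_i)$ to $\mathbf{c}_j$ be at most $R_j+\xi_i$ whenever $z_{ij}=1$), so that the constraints with $z_{ij}=0$ do not affect the optimal value. The nonnegativity of $R_j$ is not imposed explicitly in either problem. *)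

theory Defs
  imports "HOL-Analysis.Analysis"
begin

text \<open>
  Candidate solutions are tuples (R, c, xi, z) for the problem in the feature space and
  (R, alpha, xi, z) for the kernel problem. Index sets are {1..n} for the observations and {1..p}
  for the hyperspheres; values of the variables at other indices are irrelevant.
\<close>

type_synonym 'v msvdd_sol =
  "(nat \<Rightarrow> real) \<times> 'v \<times> (nat \<Rightarrow> real) \<times> (nat \<Rightarrow> nat \<Rightarrow> real)"

definition msvdd_objective :: "nat \<Rightarrow> nat \<Rightarrow> real \<Rightarrow> 'v msvdd_sol \<Rightarrow> real" where
  "msvdd_objective n p C = (\<lambda>(R, _, \<xi>, _). (\<Sum>j\<in>{1..p}. R j) + (\<Sum>i\<in>{1..n}. C * \<xi> i))"

text \<open>The optimal value is extended real: it is infinite for an infeasible problem.\<close>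

definition msvdd_value :: "nat \<Rightarrow> nat \<Rightarrow> real \<Rightarrow> 'v msvdd_sol set \<Rightarrow> ereal" where
  "msvdd_value n p C S = (INF s\<in>S. ereal (msvdd_objective n p C s))"

definition msvdd_optimal :: "nat \<Rightarrow> nat \<Rightarrow> real \<Rightarrow> 'v msvdd_sol set \<Rightarrow> 'v msvdd_sol \<Rightarrow> bool" where
  "msvdd_optimal n p C S s \<longleftrightarrow> is_arg_min (msvdd_objective n p C) (\<lambda>t. t \<in> S) s"

definition msvdd_assignment ::
  "nat \<Rightarrow> nat \<Rightarrow> (nat \<Rightarrow> real) \<Rightarrow> (nat \<Rightarrow> nat \<Rightarrow> real) \<Rightarrow> bool" where
  "msvdd_assignment n p \<xi> z \<longleftrightarrow>
     (\<forall>i\<in>{1..n}. \<forall>j\<in>{1..p}. z i j \<in> {0, 1}) \<and>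
     (\<forall>i\<in>{1..n}. (\<Sum>j\<in>{1..p}. z i j) = 1) \<and>
     (\<forall>i\<in>{1..n}. \<xi> i \<ge> 0)"

definition Phi_feasible ::
  "nat \<Rightarrow> nat \<Rightarrow> real \<Rightarrow> (nat \<Rightarrow> real ^ 'd) \<Rightarrow> (real ^ 'd \<Rightarrow> real ^ 'e) \<Rightarrow> (nat \<Rightarrow> real) \<Rightarrow>
   (nat \<Rightarrow> real ^ 'e) msvdd_sol set" where
  "Phi_feasible n p C x \<Phi> \<Delta> = {(R, c, \<xi>, z).
     (\<forall>i\<in>{1..n}. \<forall>j\<in>{1..p}.
        (norm (\<Phi> (x i) - c j))\<^sup>2 \<le> R j + \<xi> i + \<Delta> i * (1 - z i j)) \<and>
     (\<forall>j\<in>{1..p}. (\<Sum>i\<in>{1..n}. C * z i j) \<ge> 1) \<and>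
     msvdd_assignment n p \<xi> z}"

text \<open>
  The problem that the big-M formulation linearizes: the distance constraint is imposed only for
  the hypersphere to which an observation is allocated.
\<close>

definition Phi_feasible_cond ::
  "nat \<Rightarrow> nat \<Rightarrow> real \<Rightarrow> (nat \<Rightarrow> real ^ 'd) \<Rightarrow> (real ^ 'd \<Rightarrow> real ^ 'e) \<Rightarrow>
   (nat \<Rightarrow> real ^ 'e) msvdd_sol set" where
  "Phi_feasible_cond n p C x \<Phi> = {(R, c, \<xi>, z).
     (\<forall>i\<in>{1..n}. \<forall>j\<in>{1..p}. z i j = 1 \<longrightarrow> (norm (\<Phi> (x i) - c j))\<^sup>2 \<le> R j + \<xi> i) \<and>
     (\<forall>j\<in>{1..p}. (\<Sum>i\<in>{1..n}. C * z i j) \<ge> 1) \<and>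
     msvdd_assignment n p \<xi> z}"

text \<open>
  The left-hand side of the kernel constraint: the squared distance from the image of the i-th
  observation to the centre of hypersphere j, expanded for a centre that is the combination of the
  images with coefficients alpha.
\<close>

definition kernel_dist ::
  "nat \<Rightarrow> (real ^ 'd \<Rightarrow> real ^ 'd \<Rightarrow> real) \<Rightarrow> (nat \<Rightarrow> real ^ 'd) \<Rightarrow>
   (nat \<Rightarrow> nat \<Rightarrow> real) \<Rightarrow> nat \<Rightarrow> nat \<Rightarrow> real" where
  "kernel_dist n K x \<alpha> i j =
     K (x i) (x i) - 2 * (\<Sum>k\<in>{1..n}. \<alpha> k j * K (x i) (x k))
     + (\<Sum>k\<in>{1..n}. \<Sum>l\<in>{1..n}. \<alpha> k j * \<alpha> l j * K (x k) (x l))"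

definition K_feasible ::
  "nat \<Rightarrow> nat \<Rightarrow> real \<Rightarrow> (nat \<Rightarrow> real ^ 'd) \<Rightarrow> (real ^ 'd \<Rightarrow> real ^ 'd \<Rightarrow> real) \<Rightarrow>
   (nat \<Rightarrow> real) \<Rightarrow> (nat \<Rightarrow> nat \<Rightarrow> real) msvdd_sol set" where
  "K_feasible n p C x K \<Delta> = {(R, \<alpha>, \<xi>, z).
     (\<forall>i\<in>{1..n}. \<forall>j\<in>{1..p}. kernel_dist n K x \<alpha> i j \<le> R j + \<xi> i + \<Delta> i * (1 - z i j)) \<and>
     (\<forall>i\<in>{1..n}. \<forall>j\<in>{1..p}. 0 \<le> \<alpha> i j \<and> \<alpha> i j \<le> C * z i j) \<and>
     (\<forall>j\<in>{1..p}. (\<Sum>i\<in>{1..n}. \<alpha> i j) = 1) \<and>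
     msvdd_assignment n p \<xi> z}"

definition K_feasible_cond ::
  "nat \<Rightarrow> nat \<Rightarrow> real \<Rightarrow> (nat \<Rightarrow> real ^ 'd) \<Rightarrow> (real ^ 'd \<Rightarrow> real ^ 'd \<Rightarrow> real) \<Rightarrow>
   (nat \<Rightarrow> nat \<Rightarrow> real) msvdd_sol set" where
  "K_feasible_cond n p C x K = {(R, \<alpha>, \<xi>, z).
     (\<forall>i\<in>{1..n}. \<forall>j\<in>{1..p}. z i j = 1 \<longrightarrow> kernel_dist n K x \<alpha> i j \<le> R j + \<xi> i) \<and>
     (\<forall>i\<in>{1..n}. \<forall>j\<in>{1..p}. 0 \<le> \<alpha> i j \<and> \<alpha> i j \<le> C * z i j) \<and>
     (\<forall>j\<in>{1..p}. (\<Sum>i\<in>{1..n}. \<alpha> i j) = 1) \<and>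
     msvdd_assignment n p \<xi> z}"

text \<open>
  Large enough big-M constants: the constraints with z i j = 0 do not affect the optimal value.
  They cannot be required to be redundant pointwise, since R and c are unbounded.
\<close>

definition Phi_large_enough ::
  "nat \<Rightarrow> nat \<Rightarrow> real \<Rightarrow> (nat \<Rightarrow> real ^ 'd) \<Rightarrow> (real ^ 'd \<Rightarrow> real ^ 'e) \<Rightarrow> (nat \<Rightarrow> real) \<Rightarrow> bool" where
  "Phi_large_enough n p C x \<Phi> \<Delta> \<longleftrightarrow>
     msvdd_value n p C (Phi_feasible n p C x \<Phi> \<Delta>)
     = msvdd_value n p C (Phi_feasible_cond n p C x \<Phi>)"

definition K_large_enough ::
  "nat \<Rightarrow> nat \<Rightarrow> real \<Rightarrow> (nat \<Rightarrow> real ^ 'd) \<Rightarrow> (real ^ 'd \<Rightarrow> real ^ 'd \<Rightarrow> real) \<Rightarrow>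
   (nat \<Rightarrow> real) \<Rightarrow> bool" where
  "K_large_enough n p C x K \<Delta> \<longleftrightarrow>
     msvdd_value n p C (K_feasible n p C x K \<Delta>)
     = msvdd_value n p C (K_feasible_cond n p C x K)"

definition kernel_big_M ::
  "nat \<Rightarrow> real \<Rightarrow> (nat \<Rightarrow> real ^ 'd) \<Rightarrow> (real ^ 'd \<Rightarrow> real ^ 'd \<Rightarrow> real) \<Rightarrow> nat \<Rightarrow> real" where
  "kernel_big_M n C x K i =
     (let \<pi> = (\<lambda>k l. if K (x k) (x l) < 0 then C else 0) in
        K (x i) (x i) - 2 * (\<Sum>k\<in>{1..n}. \<pi> i k * K (x i) (x k))
        + (\<Sum>k\<in>{1..n}. \<Sum>l\<in>{1..n}. (C - \<pi> k l)\<^sup>2 * K (x k) (x l)))"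

end

theory Submission
  imports Defs
begin

text \<open>
  For a fixed allocation the problem splits into one problem per hypersphere. Write \<open>v i\<close> for the
  image of the i-th observation and \<open>u i\<close> for C times its allocation variable. Linear programming
  duality in (R, \<open>\<xi>\<close>) shows that the best cost of a hypersphere with centre c is the maximum of
  \<open>\<Sum>i. \<beta> i * (norm (v i - c))\<^sup>2\<close> over weights \<open>\<beta>\<close> with \<open>0 \<le> \<beta> i \<le> u i\<close> and sum 1.
  By the parallel axis identity this weighted sum depends on c only through
  \<open>(norm (a - c))\<^sup>2\<close> with \<open>a = \<Sum>i. \<beta> i *\<^sub>R v i\<close>, a point of the reduced convex hull, that is,
  of the set of all such combinations. This hull is convex and compact, so replacing c by its
  nearest point b in the hull decreases all these squared distances, hence the cost, by at least
  \<open>(norm (c - b))\<^sup>2\<close>. Therefore optimal centres lie in the hull, which is exactly the set of centres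
  that the kernel problem can represent; the kernel trick then turns the kernel expression into the
  squared distance. This argument (\<open>hypersphere_improvement\<close>, assembled over all hyperspheres in
  \<open>centres_into_reduced_hulls\<close>) gives equality of the values and, because the decrease is
  quantitative, that every optimal centre is representable.

  The big-M constraint only shrinks the feasible sets, and every kernel-feasible point is feasible
  in the feature space with the same constants. So the value of the feature space problem is squeezed
  between two equal values as soon as the constants are large enough for the kernel problem.

  The explicit constant bounds the kernel expression for all admissible coefficients, term by term.
  It is therefore large enough for solutions with nonnegative R, and a negative R can always be
  raised to 0 at no cost by lowering the errors of the observations of that hypersphere: their
  total cost coefficient is at least 1.
\<close>

section \<open>Thresholds and capped weights\<close>

text \<open>
  Strong duality for the fractional knapsack problem with capacities \<open>u\<close>: the greedy weights exhaust
  the capacities of the items whose value exceeds a threshold R, and use only part of the capacity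
  at the threshold itself. Both sides of the last equation are then equal by complementary
  slackness.
\<close>

lemma capped_weights_threshold:
  fixes u d :: "'i \<Rightarrow> real"
  assumes S: "finite S" and u: "\<And>i. i \<in> S \<Longrightarrow> 0 \<le> u i" and mass: "1 \<le> sum u S"
  obtains R \<beta> where "\<And>i. i \<in> S \<Longrightarrow> 0 \<le> \<beta> i \<and> \<beta> i \<le> u i" and "sum \<beta> S = 1"
    and "(\<Sum>i\<in>S. \<beta> i * d i) = R + (\<Sum>i\<in>S. u i * max 0 (d i - R))"
proof -
  define F where "F r = (\<Sum>i\<in>{i\<in>S. r < d i}. u i)" for r
  define T where "T = {k\<in>S. F (d k) \<le> 1}"
  have "S \<noteq> {}" using mass by auto
  then have "Max (d ` S) \<in> d ` S" using S by simp
  then obtain m where m: "m \<in> S" "d m = Max (d ` S)" by force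
  have "{i\<in>S. d m < d i} = {}" using m S by (auto simp: not_less)
  then have "F (d m) = 0" by (simp only: F_def sum.empty)
  then have "m \<in> T" using m by (simp add: T_def)
  moreover have T: "finite T" using S by (simp add: T_def)
  ultimately have "Min (d ` T) \<in> d ` T" by (intro Min_in) auto
  then obtain k where k: "k \<in> T" "d k = Min (d ` T)" by force
  define R where "R = d k"
  have R_least: "R \<le> d l" if "l \<in> T" for l using k that T by (simp add: R_def)
  define E where "E = (\<Sum>i\<in>{i\<in>S. d i = R}. u i)"
  have E0: "0 \<le> E" unfolding E_def by (rule sum_nonneg) (use u in auto)
  have F1: "F R \<le> 1" using k by (simp add: T_def R_def)
  have FE: "F R + E = (\<Sum>i\<in>{i\<in>S. R \<le> d i}. u i)"
  proof -
    have "{i\<in>S. R \<le> d i} = {i\<in>S. R < d i} \<union> {i\<in>S. d i = R}" by auto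
    then show ?thesis unfolding F_def E_def using S
      by (simp only:) (subst sum.union_disjoint, auto)
  qed
  have G1: "1 \<le> F R + E"
  proof (rule ccontr)
    assume less: "\<not> 1 \<le> F R + E"
    have "{i\<in>S. d i < R} \<noteq> {}"
    proof
      assume "{i\<in>S. d i < R} = {}"
      then have "{i\<in>S. R \<le> d i} = S" by force
      then show False using less FE mass by simp
    qed
    then have "Max (d ` {i\<in>S. d i < R}) \<in> d ` {i\<in>S. d i < R}" using S by (intro Max_in) auto
    then obtain l where l: "l \<in> S" "d l < R" "d l = Max (d ` {i\<in>S. d i < R})" by force
    have "d i \<le> d l" if "i \<in> S" "d i < R" for i using l(3) S that by simp
    then have "{i\<in>S. d l < d i} = {i\<in>S. R \<le> d i}" using l by force
    then have "l \<in> T" using l less FE by (simp add: T_def F_def)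
    then show False using R_least l by force
  qed
  \<comment> \<open>If \<open>E = 0\<close>, the convention \<open>x / 0 = 0\<close> gives the correct fraction 0.\<close>
  define \<theta> where "\<theta> = (1 - F R) / E"
  have \<theta>: "0 \<le> \<theta>" "\<theta> \<le> 1" "\<theta> * E = 1 - F R"
    using E0 F1 G1 by (cases "E = 0"; simp add: \<theta>_def divide_simps)+
  define \<beta> where "\<beta> i = (if R < d i then u i else if d i = R then \<theta> * u i else 0)" for i
  have cap: "0 \<le> \<beta> i \<and> \<beta> i \<le> u i" if "i \<in> S" for i
    using u[OF that] \<theta> by (auto simp: \<beta>_def mult_left_le_one_le)
  have "sum \<beta> S = (\<Sum>i\<in>S. (if R < d i then u i else 0) + (if d i = R then \<theta> * u i else 0))"
    by (rule sum.cong) (auto simp: \<beta>_def)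
  also have "\<dots> = F R + \<theta> * E"
    using S by (simp add: sum.distrib F_def E_def sum_distrib_left sum.If_cases Int_def)
  finally have one: "sum \<beta> S = 1" using \<theta> by simp
  have "(\<Sum>i\<in>S. \<beta> i * d i) = (\<Sum>i\<in>S. \<beta> i * R + u i * max 0 (d i - R))"
    by (rule sum.cong) (auto simp: \<beta>_def algebra_simps)
  also have "\<dots> = R + (\<Sum>i\<in>S. u i * max 0 (d i - R))"
    using one by (simp add: sum.distrib flip: sum_distrib_right)
  finally show thesis using that cap one by blast
qed

section \<open>Reduced convex hulls\<close>

definition capped_weights :: "'i set \<Rightarrow> ('i \<Rightarrow> real) \<Rightarrow> ('i \<Rightarrow> real) set" where
  "capped_weights S u = {\<alpha>. (\<forall>i\<in>S. 0 \<le> \<alpha> i \<and> \<alpha> i \<le> u i) \<and> sum \<alpha> S = 1}"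

definition combination :: "'i set \<Rightarrow> ('i \<Rightarrow> 'v::real_vector) \<Rightarrow> ('i \<Rightarrow> real) \<Rightarrow> 'v" where
  "combination S v \<alpha> = (\<Sum>i\<in>S. \<alpha> i *\<^sub>R v i)"

lemma convex_reduced_hull: "convex (combination S v ` capped_weights S u)"
proof (rule convexI)
  fix a b and s t :: real
  assume "a \<in> combination S v ` capped_weights S u" "b \<in> combination S v ` capped_weights S u"
    and st: "0 \<le> s" "0 \<le> t" "s + t = 1"
  then obtain \<alpha> \<beta> where ab: "\<alpha> \<in> capped_weights S u" "a = combination S v \<alpha>"
    "\<beta> \<in> capped_weights S u" "b = combination S v \<beta>" by blast
  have "s * \<alpha> i + t * \<beta> i \<le> u i" if "i \<in> S" for i
  proof -
    have "s * \<alpha> i + t * \<beta> i \<le> s * u i + t * u i"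
      using ab st that by (intro add_mono mult_left_mono) (auto simp: capped_weights_def)
    then show ?thesis using st by (simp flip: distrib_right)
  qed
  then have "(\<lambda>i. s * \<alpha> i + t * \<beta> i) \<in> capped_weights S u"
    using ab st by (simp add: capped_weights_def sum.distrib flip: sum_distrib_left)
  moreover have "s *\<^sub>R a + t *\<^sub>R b = combination S v (\<lambda>i. s * \<alpha> i + t * \<beta> i)"
    by (simp add: ab combination_def scaleR_sum_right scaleR_add_left sum.distrib)
  ultimately show "s *\<^sub>R a + t *\<^sub>R b \<in> combination S v ` capped_weights S u" by blast
qed

text \<open>
  Weights outside \<open>S\<close> do not enter the combination, so they may be taken to be 0. The capped weights
  then form a closed part of a product of compact intervals, compact by Tychonoff's theorem.
\<close>

lemma compact_reduced_hull:
  fixes v :: "'i \<Rightarrow> 'v::real_normed_vector"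
  shows "compact (combination S v ` capped_weights S u)"
proof -
  define Q where "Q = (\<Pi>\<^sub>E i\<in>UNIV. {0..(if i \<in> S then u i else 0)})"
  define W where "W = Q \<inter> {\<alpha>. sum \<alpha> S = 1}"
  have "compact Q"
    unfolding Q_def compactin_euclidean_iff[symmetric] euclidean_product_topology[symmetric]
    by (subst compactin_PiE) simp
  moreover have "closed {\<alpha>::'i \<Rightarrow> real. sum \<alpha> S = 1}"
    by (intro closed_Collect_eq continuous_intros continuous_on_product_coordinates)
  ultimately have "compact W" unfolding W_def by (rule compact_Int_closed)
  then have "compact (combination S v ` W)"
    unfolding combination_def
    by (intro compact_continuous_image continuous_intros
        continuous_on_subset[OF continuous_on_product_coordinates subset_UNIV])
  moreover have "combination S v ` W = combination S v ` capped_weights S u"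
  proof (intro equalityI image_subsetI)
    fix \<alpha> assume "\<alpha> \<in> W"
    then have "\<alpha> \<in> capped_weights S u"
      by (fastforce simp: W_def Q_def capped_weights_def split: if_splits)
    then show "combination S v \<alpha> \<in> combination S v ` capped_weights S u" by blast
  next
    fix \<alpha> assume \<alpha>: "\<alpha> \<in> capped_weights S u"
    define \<alpha>' where "\<alpha>' i = (if i \<in> S then \<alpha> i else 0)" for i
    have "sum \<alpha>' S = sum \<alpha> S" by (rule sum.cong) (auto simp: \<alpha>'_def)
    then have "\<alpha>' \<in> W" using \<alpha> by (auto simp: W_def Q_def capped_weights_def \<alpha>'_def)
    moreover have "combination S v \<alpha> = combination S v \<alpha>'"
      unfolding combination_def by (rule sum.cong) (auto simp: \<alpha>'_def)
    ultimately show "combination S v \<alpha> \<in> combination S v ` W" by blast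
  qed
  ultimately show ?thesis by simp
qed

text \<open>The parallel axis identity, in the form that compares two reference points.\<close>

lemma weighted_square_dist_shift:
  fixes v :: "'i \<Rightarrow> 'v::real_inner"
  assumes "sum \<beta> S = 1"
  shows "(\<Sum>i\<in>S. \<beta> i * (norm (v i - c))\<^sup>2) - (\<Sum>i\<in>S. \<beta> i * (norm (v i - b))\<^sup>2)
    = (norm (combination S v \<beta> - c))\<^sup>2 - (norm (combination S v \<beta> - b))\<^sup>2"
proof -
  have diff: "(norm (w - c))\<^sup>2 - (norm (w - b))\<^sup>2 = (c \<bullet> c - b \<bullet> b) - 2 * (w \<bullet> (c - b))" for w :: 'v
    by (simp add: power2_norm_eq_inner algebra_simps inner_commute)
  have "(\<Sum>i\<in>S. \<beta> i * (norm (v i - c))\<^sup>2) - (\<Sum>i\<in>S. \<beta> i * (norm (v i - b))\<^sup>2)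
      = (\<Sum>i\<in>S. \<beta> i * (c \<bullet> c - b \<bullet> b) - 2 * ((\<beta> i *\<^sub>R v i) \<bullet> (c - b)))"
    unfolding sum_subtractf[symmetric]
  proof (rule sum.cong)
    fix i
    have "\<beta> i * (norm (v i - c))\<^sup>2 - \<beta> i * (norm (v i - b))\<^sup>2
        = \<beta> i * ((c \<bullet> c - b \<bullet> b) - 2 * (v i \<bullet> (c - b)))"
      by (metis diff right_diff_distrib)
    then show "\<beta> i * (norm (v i - c))\<^sup>2 - \<beta> i * (norm (v i - b))\<^sup>2
        = \<beta> i * (c \<bullet> c - b \<bullet> b) - 2 * ((\<beta> i *\<^sub>R v i) \<bullet> (c - b))"
      by (simp add: right_diff_distrib mult_ac)
  qed simp
  also have "\<dots> = sum \<beta> S * (c \<bullet> c - b \<bullet> b) - 2 * (combination S v \<beta> \<bullet> (c - b))"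
    unfolding combination_def inner_sum_left sum_distrib_left sum_distrib_right sum_subtractf ..
  also have "\<dots> = (norm (combination S v \<beta> - c))\<^sup>2 - (norm (combination S v \<beta> - b))\<^sup>2"
    by (simp only: diff assms mult_1)
  finally show ?thesis .
qed

text \<open>
  The nearest point b of the reduced hull serves as the new centre. The threshold weights \<open>\<beta>\<close> for the
  distances to b certify the optimal cost at b, and are used as a lower bound for the cost at c.
  The two bounds differ by \<open>(norm (a - c))\<^sup>2 - (norm (a - b))\<^sup>2\<close> with a in the hull, which is
  at least \<open>(norm (c - b))\<^sup>2\<close> because the angle at b is not acute.
\<close>

lemma hypersphere_improvement:
  fixes v :: "'i \<Rightarrow> 'v::euclidean_space"
  assumes S: "finite S" and u: "\<And>i. i \<in> S \<Longrightarrow> 0 \<le> u i" and mass: "1 \<le> sum u S"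
    and dist: "\<And>i. i \<in> S \<Longrightarrow> 0 < u i \<Longrightarrow> (norm (v i - c))\<^sup>2 \<le> R + \<xi> i"
    and \<xi>: "\<And>i. i \<in> S \<Longrightarrow> 0 \<le> \<xi> i"
  shows "\<exists>R' \<alpha>. \<alpha> \<in> capped_weights S u \<and>
    R' + (\<Sum>i\<in>S. u i * max 0 ((norm (v i - combination S v \<alpha>))\<^sup>2 - R'))
      + (norm (c - combination S v \<alpha>))\<^sup>2 \<le> R + (\<Sum>i\<in>S. u i * \<xi> i)"
proof -
  define H where "H = combination S v ` capped_weights S u"
  have H: "convex H" "closed H"
    by (simp_all add: H_def convex_reduced_hull compact_imp_closed compact_reduced_hull)
  define b where "b = closest_point H c"
  obtain R' \<beta> where "\<And>i. i \<in> S \<Longrightarrow> 0 \<le> \<beta> i \<and> \<beta> i \<le> u i" "sum \<beta> S = 1"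
    and dual: "(\<Sum>i\<in>S. \<beta> i * (norm (v i - b))\<^sup>2)
      = R' + (\<Sum>i\<in>S. u i * max 0 ((norm (v i - b))\<^sup>2 - R'))"
    by (rule capped_weights_threshold[OF S u mass, where d = "\<lambda>i. (norm (v i - b))\<^sup>2"])
       (assumption, rule that)
  then have \<beta>: "\<And>i. i \<in> S \<Longrightarrow> 0 \<le> \<beta> i" "\<And>i. i \<in> S \<Longrightarrow> \<beta> i \<le> u i" "sum \<beta> S = 1"
    by auto
  define a where "a = combination S v \<beta>"
  have a: "a \<in> H" using \<beta> by (auto simp: H_def a_def capped_weights_def)
  then have "b \<in> H" unfolding b_def using H by (intro closest_point_in_set) auto
  then obtain \<alpha> where \<alpha>: "\<alpha> \<in> capped_weights S u" "b = combination S v \<alpha>" by (auto simp: H_def)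
  have "(c - b) \<bullet> (a - b) \<le> 0" unfolding b_def using H a by (rule closest_point_dot)
  then have obtuse: "(norm (a - b))\<^sup>2 + (norm (c - b))\<^sup>2 \<le> (norm (a - c))\<^sup>2"
    by (simp add: power2_norm_eq_inner algebra_simps inner_commute)
  have "(\<Sum>i\<in>S. \<beta> i * (norm (v i - c))\<^sup>2) \<le> (\<Sum>i\<in>S. \<beta> i * R + u i * \<xi> i)"
  proof (rule sum_mono)
    fix i assume i: "i \<in> S"
    have "\<beta> i * (norm (v i - c))\<^sup>2 \<le> \<beta> i * (R + \<xi> i)"
    proof (cases "u i = 0")
      case True
      then have "\<beta> i = 0" using \<beta>(1,2)[OF i] by simp
      then show ?thesis by simp
    next
      case False
      then have "0 < u i" using u[OF i] by simp
      then show ?thesis using \<beta>(1) dist i by (intro mult_left_mono)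
    qed
    also have "\<dots> \<le> \<beta> i * R + u i * \<xi> i"
      using \<beta> \<xi> i by (simp add: distrib_left mult_right_mono)
    finally show "\<beta> i * (norm (v i - c))\<^sup>2 \<le> \<beta> i * R + u i * \<xi> i" .
  qed
  also have "\<dots> = R + (\<Sum>i\<in>S. u i * \<xi> i)"
    using \<beta> by (simp add: sum.distrib flip: sum_distrib_right)
  finally have "(\<Sum>i\<in>S. \<beta> i * (norm (v i - c))\<^sup>2) \<le> R + (\<Sum>i\<in>S. u i * \<xi> i)" .
  then have "R' + (\<Sum>i\<in>S. u i * max 0 ((norm (v i - b))\<^sup>2 - R')) + (norm (c - b))\<^sup>2
      \<le> R + (\<Sum>i\<in>S. u i * \<xi> i)"
    using weighted_square_dist_shift[OF \<beta>(3), of v c b] dual obtuse unfolding a_def by linarith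
  then show ?thesis using \<alpha> by blast
qed

section \<open>Values and optimal solutions\<close>

lemma msvdd_value_mono:
  assumes "\<And>s. s \<in> S \<Longrightarrow> \<exists>t\<in>T. msvdd_objective n p C t \<le> msvdd_objective n p C s"
  shows "msvdd_value n p C T \<le> msvdd_value n p C S"
  unfolding msvdd_value_def by (rule INF_mono) (use assms in auto)

lemma msvdd_optimal_iff_value:
  "msvdd_optimal n p C S s \<longleftrightarrow>
    s \<in> S \<and> msvdd_value n p C S = ereal (msvdd_objective n p C s)"
proof
  assume "msvdd_optimal n p C S s"
  then have s: "s \<in> S" "\<And>t. t \<in> S \<Longrightarrow> msvdd_objective n p C s \<le> msvdd_objective n p C t"
    by (auto simp: msvdd_optimal_def is_arg_min_def not_less)
  then have "msvdd_value n p C S = ereal (msvdd_objective n p C s)"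
    unfolding msvdd_value_def by (intro INF_eqI) auto
  then show "s \<in> S \<and> msvdd_value n p C S = ereal (msvdd_objective n p C s)" using s by simp
next
  assume s: "s \<in> S \<and> msvdd_value n p C S = ereal (msvdd_objective n p C s)"
  have "msvdd_objective n p C s \<le> msvdd_objective n p C t" if "t \<in> S" for t
    using INF_lower[OF that, of "\<lambda>s. ereal (msvdd_objective n p C s)"] s
    by (simp add: msvdd_value_def)
  then show "msvdd_optimal n p C S s"
    using s by (auto simp: msvdd_optimal_def is_arg_min_def not_less)
qed

lemma msvdd_objective_cong:
  "msvdd_objective n p C (R, c, \<xi>, z) = msvdd_objective n p C (R, c', \<xi>, z)"
  by (simp add: msvdd_objective_def)

lemma Phi_feasible_subset_cond: "Phi_feasible n p C x \<Phi> \<Delta> \<subseteq> Phi_feasible_cond n p C x \<Phi>"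
  by (fastforce simp: Phi_feasible_def Phi_feasible_cond_def)

lemma K_feasible_subset_cond: "K_feasible n p C x K \<Delta> \<subseteq> K_feasible_cond n p C x K"
  by (fastforce simp: K_feasible_def K_feasible_cond_def)

text \<open>
  Exchanging the order of summation redistributes a cost on observations over the hyperspheres: every
  observation counts once since its allocation variables add up to 1.
\<close>

lemma sum_over_allocation:
  assumes "msvdd_assignment n p \<xi> z"
  shows "(\<Sum>j\<in>{1..p}. \<Sum>i\<in>{1..n}. C * z i j * \<xi> i) = (\<Sum>i\<in>{1..n}. C * \<xi> i)"
proof -
  have "(\<Sum>j\<in>{1..p}. \<Sum>i\<in>{1..n}. C * z i j * \<xi> i) = (\<Sum>i\<in>{1..n}. \<Sum>j\<in>{1..p}. C * \<xi> i * z i j)"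
    by (subst sum.swap) (simp add: mult_ac)
  also have "\<dots> = (\<Sum>i\<in>{1..n}. C * \<xi> i)"
    using assms by (intro sum.cong) (simp_all add: msvdd_assignment_def flip: sum_distrib_left)
  finally show ?thesis .
qed

section \<open>The feature space problem and the kernel problem\<close>

lemma kernel_dist_eq_norm:
  assumes "\<And>u v. K u v = \<Phi> u \<bullet> \<Phi> v"
  shows "kernel_dist n K x \<alpha> i j
    = (norm (\<Phi> (x i) - (\<Sum>k\<in>{1..n}. \<alpha> k j *\<^sub>R \<Phi> (x k))))\<^sup>2"
proof -
  define a where "a = (\<Sum>k\<in>{1..n}. \<alpha> k j *\<^sub>R \<Phi> (x k))"
  have "\<Phi> (x i) \<bullet> a = (\<Sum>k\<in>{1..n}. \<alpha> k j * K (x i) (x k))"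
    by (simp add: a_def inner_sum_right assms)
  moreover have "a \<bullet> a = (\<Sum>k\<in>{1..n}. \<Sum>l\<in>{1..n}. \<alpha> k j * \<alpha> l j * K (x k) (x l))"
    by (simp add: a_def inner_sum_right inner_sum_left assms sum_distrib_left mult_ac)
       (subst sum.swap, simp add: inner_commute mult_ac)
  moreover have "(norm (\<Phi> (x i) - a))\<^sup>2 = \<Phi> (x i) \<bullet> \<Phi> (x i) - 2 * (\<Phi> (x i) \<bullet> a) + a \<bullet> a"
    by (simp add: power2_norm_eq_inner algebra_simps inner_commute)
  ultimately show ?thesis by (simp add: kernel_dist_def assms a_def)
qed

text \<open>The coefficients of a hypersphere add up to 1, so their upper bounds do at least.\<close>

lemma capped_coefficients_mass:
  assumes "\<forall>i\<in>{1..n}. \<forall>j\<in>{1..p}. 0 \<le> \<alpha> i j \<and> \<alpha> i j \<le> C * z i j"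
    and "\<forall>j\<in>{1..p}. (\<Sum>i\<in>{1..n}. \<alpha> i j) = 1" and "j \<in> {1..p}"
  shows "(1::real) \<le> (\<Sum>i\<in>{1..n}. C * z i j)"
proof -
  have "(1::real) = (\<Sum>i\<in>{1..n}. \<alpha> i j)" using assms by simp
  also have "\<dots> \<le> (\<Sum>i\<in>{1..n}. C * z i j)" using assms by (intro sum_mono) auto
  finally show ?thesis .
qed

lemma K_feasible_imp_Phi_feasible:
  assumes K: "\<And>u v. K u v = \<Phi> u \<bullet> \<Phi> v" and s: "(R, \<alpha>, \<xi>, z) \<in> K_feasible n p C x K \<Delta>"
  shows "(R, (\<lambda>j. \<Sum>i\<in>{1..n}. \<alpha> i j *\<^sub>R \<Phi> (x i)), \<xi>, z) \<in> Phi_feasible n p C x \<Phi> \<Delta>"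
  using s capped_coefficients_mass[of n p \<alpha> C z]
  by (simp add: K_feasible_def Phi_feasible_def kernel_dist_eq_norm[of K \<Phi>, OF K])

lemma K_feasible_cond_imp_Phi_feasible_cond:
  assumes K: "\<And>u v. K u v = \<Phi> u \<bullet> \<Phi> v" and s: "(R, \<alpha>, \<xi>, z) \<in> K_feasible_cond n p C x K"
  shows "(R, (\<lambda>j. \<Sum>i\<in>{1..n}. \<alpha> i j *\<^sub>R \<Phi> (x i)), \<xi>, z) \<in> Phi_feasible_cond n p C x \<Phi>"
  using s capped_coefficients_mass[of n p \<alpha> C z]
  by (simp add: K_feasible_cond_def Phi_feasible_cond_def kernel_dist_eq_norm[of K \<Phi>, OF K])

text \<open>
  The improvements of the single hyperspheres are combined without changing the allocation. The
  decrease of the objective is kept explicit: it forces an optimal centre to be equal to the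
  combination that replaces it.
\<close>

lemma centres_into_reduced_hulls:
  fixes \<Phi> :: "real ^ 'd \<Rightarrow> real ^ 'e"
  assumes C: "0 < C" and K: "\<And>u v. K u v = \<Phi> u \<bullet> \<Phi> v"
    and s: "(R, c, \<xi>, z) \<in> Phi_feasible_cond n p C x \<Phi>"
  obtains R' \<alpha> \<xi>' where "(R', \<alpha>, \<xi>', z) \<in> K_feasible_cond n p C x K"
    and "msvdd_objective n p C (R', \<alpha>, \<xi>', z)
      + (\<Sum>j\<in>{1..p}. (norm (c j - (\<Sum>i\<in>{1..n}. \<alpha> i j *\<^sub>R \<Phi> (x i))))\<^sup>2)
      \<le> msvdd_objective n p C (R, c, \<xi>, z)"
proof -
  let ?N = "{1..n}" and ?P = "{1..p}" and ?v = "\<lambda>i. \<Phi> (x i)"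
  have z: "z i j = 0 \<or> z i j = 1" if "i \<in> ?N" "j \<in> ?P" for i j
    using s that by (auto simp: Phi_feasible_cond_def msvdd_assignment_def)
  have asg: "msvdd_assignment n p \<xi> z" using s by (simp add: Phi_feasible_cond_def)
  have "\<forall>j\<in>?P. \<exists>q. snd q \<in> capped_weights ?N (\<lambda>i. C * z i j) \<and>
      fst q + (\<Sum>i\<in>?N. C * z i j * max 0 ((norm (?v i - combination ?N ?v (snd q)))\<^sup>2 - fst q))
        + (norm (c j - combination ?N ?v (snd q)))\<^sup>2 \<le> R j + (\<Sum>i\<in>?N. C * z i j * \<xi> i)"
  proof
    fix j assume j: "j \<in> ?P"
    have "0 \<le> C * z i j" if "i \<in> ?N" for i using z[OF that j] C by auto
    moreover have "1 \<le> (\<Sum>i\<in>?N. C * z i j)" using s j by (simp add: Phi_feasible_cond_def)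
    moreover have "(norm (?v i - c j))\<^sup>2 \<le> R j + \<xi> i" if "i \<in> ?N" "0 < C * z i j" for i
      using s j that z[OF that(1) j] by (auto simp: Phi_feasible_cond_def)
    moreover have "0 \<le> \<xi> i" if "i \<in> ?N" for i using asg that by (simp add: msvdd_assignment_def)
    ultimately show "\<exists>q. snd q \<in> capped_weights ?N (\<lambda>i. C * z i j) \<and>
      fst q + (\<Sum>i\<in>?N. C * z i j * max 0 ((norm (?v i - combination ?N ?v (snd q)))\<^sup>2 - fst q))
        + (norm (c j - combination ?N ?v (snd q)))\<^sup>2 \<le> R j + (\<Sum>i\<in>?N. C * z i j * \<xi> i)"
      using hypersphere_improvement[of ?N "\<lambda>i. C * z i j" ?v "c j" "R j" \<xi>] by force
  qed
  from bchoice[OF this] obtain q where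
    q: "\<And>j. j \<in> ?P \<Longrightarrow> snd (q j) \<in> capped_weights ?N (\<lambda>i. C * z i j)"
    and improve: "\<And>j. j \<in> ?P \<Longrightarrow> fst (q j) + (\<Sum>i\<in>?N. C * z i j *
        max 0 ((norm (?v i - combination ?N ?v (snd (q j))))\<^sup>2 - fst (q j)))
        + (norm (c j - combination ?N ?v (snd (q j))))\<^sup>2 \<le> R j + (\<Sum>i\<in>?N. C * z i j * \<xi> i)"
    by blast
  define R' where "R' j = fst (q j)" for j
  define \<alpha> where "\<alpha> i j = snd (q j) i" for i j
  define b where "b j = (\<Sum>i\<in>?N. \<alpha> i j *\<^sub>R ?v i)" for j
  have b: "combination ?N ?v (snd (q j)) = b j" for j
    by (simp add: combination_def b_def \<alpha>_def)
  define excess where "excess i j = max 0 ((norm (?v i - b j))\<^sup>2 - R' j)" for i j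
  define \<xi>' where "\<xi>' i = (\<Sum>j\<in>?P. z i j * excess i j)" for i
  have nonneg: "0 \<le> z i j * excess i j" if "i \<in> ?N" "j \<in> ?P" for i j
    using z[OF that] by (auto simp: excess_def)
  have "(norm (?v i - b j))\<^sup>2 \<le> R' j + \<xi>' i" if ij: "i \<in> ?N" "j \<in> ?P" and "z i j = 1" for i j
  proof -
    have "z i j * excess i j \<le> \<xi>' i"
      unfolding \<xi>'_def using ij nonneg by (intro member_le_sum) auto
    then show ?thesis using \<open>z i j = 1\<close> by (simp add: excess_def)
  qed
  moreover have "0 \<le> \<xi>' i" if "i \<in> ?N" for i
    unfolding \<xi>'_def by (rule sum_nonneg) (use nonneg that in auto)
  ultimately have "(R', \<alpha>, \<xi>', z) \<in> K_feasible_cond n p C x K"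
    using q asg
    by (auto simp: K_feasible_cond_def kernel_dist_eq_norm[of K \<Phi>, OF K] b_def msvdd_assignment_def
        capped_weights_def \<alpha>_def)
  moreover have "msvdd_objective n p C (R', \<alpha>, \<xi>', z) + (\<Sum>j\<in>?P. (norm (c j - b j))\<^sup>2)
      \<le> msvdd_objective n p C (R, c, \<xi>, z)"
  proof -
    have "(\<Sum>i\<in>?N. C * \<xi>' i) = (\<Sum>j\<in>?P. \<Sum>i\<in>?N. C * z i j * excess i j)"
      unfolding \<xi>'_def sum_distrib_left by (subst sum.swap) (simp add: mult_ac)
    then have "msvdd_objective n p C (R', \<alpha>, \<xi>', z) + (\<Sum>j\<in>?P. (norm (c j - b j))\<^sup>2)
        = (\<Sum>j\<in>?P. R' j + (\<Sum>i\<in>?N. C * z i j * excess i j) + (norm (c j - b j))\<^sup>2)"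
      by (simp add: msvdd_objective_def sum.distrib)
    also have "\<dots> \<le> (\<Sum>j\<in>?P. R j + (\<Sum>i\<in>?N. C * z i j * \<xi> i))"
      by (intro sum_mono) (use improve[unfolded b] in \<open>simp add: excess_def R'_def\<close>)
    also have "\<dots> = msvdd_objective n p C (R, c, \<xi>, z)"
      using sum_over_allocation[OF asg, of C] by (simp add: msvdd_objective_def sum.distrib)
    finally show ?thesis .
  qed
  ultimately show thesis using that unfolding b_def by blast
qed

lemma conditional_values_eq:
  fixes \<Phi> :: "real ^ 'd \<Rightarrow> real ^ 'e"
  assumes C: "0 < C" and K: "\<And>u v. K u v = \<Phi> u \<bullet> \<Phi> v"
  shows "msvdd_value n p C (Phi_feasible_cond n p C x \<Phi>)
    = msvdd_value n p C (K_feasible_cond n p C x K)"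
proof (rule antisym; rule msvdd_value_mono)
  fix s assume s: "s \<in> K_feasible_cond n p C x K"
  obtain R \<alpha> \<xi> z where [simp]: "s = (R, \<alpha>, \<xi>, z)" by (cases s) auto
  show "\<exists>t\<in>Phi_feasible_cond n p C x \<Phi>. msvdd_objective n p C t \<le> msvdd_objective n p C s"
    by (rule bexI[OF _ K_feasible_cond_imp_Phi_feasible_cond[where K = K, OF K]])
       (use s in \<open>simp_all add: msvdd_objective_def\<close>)
next
  fix s assume s: "s \<in> Phi_feasible_cond n p C x \<Phi>"
  obtain R c \<xi> z where [simp]: "s = (R, c, \<xi>, z)" by (cases s) auto
  obtain R' \<alpha> \<xi>' where t: "(R', \<alpha>, \<xi>', z) \<in> K_feasible_cond n p C x K"
    and le: "msvdd_objective n p C (R', \<alpha>, \<xi>', z)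
      + (\<Sum>j\<in>{1..p}. (norm (c j - (\<Sum>i\<in>{1..n}. \<alpha> i j *\<^sub>R \<Phi> (x i))))\<^sup>2)
      \<le> msvdd_objective n p C (R, c, \<xi>, z)"
    using centres_into_reduced_hulls[where K = K, OF C K s[simplified]] .
  have "0 \<le> (\<Sum>j\<in>{1..p}. (norm (c j - (\<Sum>i\<in>{1..n}. \<alpha> i j *\<^sub>R \<Phi> (x i))))\<^sup>2)"
    by (rule sum_nonneg) simp
  then show "\<exists>t\<in>K_feasible_cond n p C x K. msvdd_objective n p C t \<le> msvdd_objective n p C s"
    using t le by (intro bexI[OF _ t]) simp
qed

text \<open>
  The feature space problem with the same constants lies between the kernel problem, whose solutions
  it contains, and the conditional problem, which relaxes it.
\<close>

lemma Phi_value_eq_K_value: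
  fixes \<Phi> :: "real ^ 'd \<Rightarrow> real ^ 'e"
  assumes C: "0 < C" and K: "\<And>u v. K u v = \<Phi> u \<bullet> \<Phi> v" and large: "K_large_enough n p C x K \<Delta>"
  shows "msvdd_value n p C (Phi_feasible n p C x \<Phi> \<Delta>)
    = msvdd_value n p C (K_feasible n p C x K \<Delta>)"
proof (rule antisym)
  show "msvdd_value n p C (Phi_feasible n p C x \<Phi> \<Delta>) \<le> msvdd_value n p C (K_feasible n p C x K \<Delta>)"
  proof (rule msvdd_value_mono)
    fix s assume s: "s \<in> K_feasible n p C x K \<Delta>"
    obtain R \<alpha> \<xi> z where [simp]: "s = (R, \<alpha>, \<xi>, z)" by (cases s) auto
    show "\<exists>t\<in>Phi_feasible n p C x \<Phi> \<Delta>. msvdd_objective n p C t \<le> msvdd_objective n p C s"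
      by (rule bexI[OF _ K_feasible_imp_Phi_feasible[where K = K, OF K]])
         (use s in \<open>simp_all add: msvdd_objective_def\<close>)
  qed
  have "msvdd_value n p C (K_feasible n p C x K \<Delta>)
      = msvdd_value n p C (Phi_feasible_cond n p C x \<Phi>)"
    using large conditional_values_eq[where K = K, OF C K] by (simp add: K_large_enough_def)
  also have "\<dots> \<le> msvdd_value n p C (Phi_feasible n p C x \<Phi> \<Delta>)"
    by (rule msvdd_value_mono) (use Phi_feasible_subset_cond in blast)
  finally show "msvdd_value n p C (K_feasible n p C x K \<Delta>)
      \<le> msvdd_value n p C (Phi_feasible n p C x \<Phi> \<Delta>)" .
qed

text \<open>
  Moving the centres of an optimal solution into the reduced hulls cannot lower the objective, so
  the centres were there already; only the coefficients of the improved solution are kept.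
\<close>

lemma optimal_K_from_optimal_Phi:
  fixes \<Phi> :: "real ^ 'd \<Rightarrow> real ^ 'e"
  assumes C: "0 < C" and K: "\<And>u v. K u v = \<Phi> u \<bullet> \<Phi> v" and large: "K_large_enough n p C x K \<Delta>"
    and opt: "msvdd_optimal n p C (Phi_feasible n p C x \<Phi> \<Delta>) (R, c, \<xi>, z)"
  shows "\<exists>\<alpha>. (\<forall>j\<in>{1..p}. c j = (\<Sum>i\<in>{1..n}. \<alpha> i j *\<^sub>R \<Phi> (x i))) \<and>
    msvdd_optimal n p C (K_feasible n p C x K \<Delta>) (R, \<alpha>, \<xi>, z)"
proof -
  have s: "(R, c, \<xi>, z) \<in> Phi_feasible n p C x \<Phi> \<Delta>"
    and val: "msvdd_value n p C (K_feasible n p C x K \<Delta>) = ereal (msvdd_objective n p C (R, c, \<xi>, z))"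
    using opt Phi_value_eq_K_value[where K = K, OF C K large] by (auto simp: msvdd_optimal_iff_value)
  obtain R' \<alpha> \<xi>' where t: "(R', \<alpha>, \<xi>', z) \<in> K_feasible_cond n p C x K"
    and le: "msvdd_objective n p C (R', \<alpha>, \<xi>', z)
      + (\<Sum>j\<in>{1..p}. (norm (c j - (\<Sum>i\<in>{1..n}. \<alpha> i j *\<^sub>R \<Phi> (x i))))\<^sup>2)
      \<le> msvdd_objective n p C (R, c, \<xi>, z)"
    using centres_into_reduced_hulls[where K = K, OF C K subsetD[OF Phi_feasible_subset_cond s]] .
  have "ereal (msvdd_objective n p C (R, c, \<xi>, z)) \<le> ereal (msvdd_objective n p C (R', \<alpha>, \<xi>', z))"
    using val large INF_lower[OF t, of "\<lambda>s. ereal (msvdd_objective n p C s)"]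
    by (simp add: K_large_enough_def msvdd_value_def)
  then have "(\<Sum>j\<in>{1..p}. (norm (c j - (\<Sum>i\<in>{1..n}. \<alpha> i j *\<^sub>R \<Phi> (x i))))\<^sup>2) \<le> 0"
    using le by simp
  then have "(\<Sum>j\<in>{1..p}. (norm (c j - (\<Sum>i\<in>{1..n}. \<alpha> i j *\<^sub>R \<Phi> (x i))))\<^sup>2) = 0"
    by (intro antisym sum_nonneg) auto
  then have c: "\<forall>j\<in>{1..p}. c j = (\<Sum>i\<in>{1..n}. \<alpha> i j *\<^sub>R \<Phi> (x i))"
    by (subst (asm) sum_nonneg_eq_0_iff) auto
  then have "(R, \<alpha>, \<xi>, z) \<in> K_feasible n p C x K \<Delta>"
    using s t
    by (auto simp: K_feasible_def K_feasible_cond_def Phi_feasible_def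
        kernel_dist_eq_norm[of K \<Phi>, OF K])
  then show ?thesis
    using c val msvdd_objective_cong[of n p C R c \<xi> z \<alpha>] by (auto simp: msvdd_optimal_iff_value)
qed

lemma optimal_Phi_from_optimal_K:
  fixes \<Phi> :: "real ^ 'd \<Rightarrow> real ^ 'e"
  assumes C: "0 < C" and K: "\<And>u v. K u v = \<Phi> u \<bullet> \<Phi> v" and large: "K_large_enough n p C x K \<Delta>"
    and opt: "msvdd_optimal n p C (K_feasible n p C x K \<Delta>) (R, \<alpha>, \<xi>, z)"
  shows "msvdd_optimal n p C (Phi_feasible n p C x \<Phi> \<Delta>)
    (R, (\<lambda>j. \<Sum>i\<in>{1..n}. \<alpha> i j *\<^sub>R \<Phi> (x i)), \<xi>, z)"
  using opt K_feasible_imp_Phi_feasible[where K = K, OF K] Phi_value_eq_K_value[where K = K, OF C K large]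
    msvdd_objective_cong[of n p C R \<alpha> \<xi> z]
  by (simp add: msvdd_optimal_iff_value)

section \<open>The explicit constant\<close>

text \<open>
  Each coefficient lies between 0 and C. A negative kernel value therefore raises the linear part by
  at most \<open>2 * C\<close> times its absolute value and never raises the quadratic part; a nonnegative one
  never raises the linear part and raises the quadratic part by at most \<open>C\<^sup>2\<close> times itself.
\<close>

lemma kernel_dist_le_kernel_big_M:
  assumes \<alpha>: "\<And>k. k \<in> {1..n} \<Longrightarrow> 0 \<le> \<alpha> k j \<and> \<alpha> k j \<le> C"
  shows "kernel_dist n K x \<alpha> i j \<le> kernel_big_M n C x K i"
proof -
  define \<pi> where "\<pi> k l = (if K (x k) (x l) < 0 then C else 0)" for k l
  have "(\<Sum>k\<in>{1..n}. \<pi> i k * K (x i) (x k)) \<le> (\<Sum>k\<in>{1..n}. \<alpha> k j * K (x i) (x k))"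
    using \<alpha> by (intro sum_mono) (auto simp: \<pi>_def mult_right_mono_neg)
  moreover have "(\<Sum>k\<in>{1..n}. \<Sum>l\<in>{1..n}. \<alpha> k j * \<alpha> l j * K (x k) (x l))
      \<le> (\<Sum>k\<in>{1..n}. \<Sum>l\<in>{1..n}. (C - \<pi> k l)\<^sup>2 * K (x k) (x l))"
  proof (intro sum_mono)
    fix k l assume "k \<in> {1..n}" "l \<in> {1..n}"
    then have prod: "0 \<le> \<alpha> k j * \<alpha> l j" "\<alpha> k j * \<alpha> l j \<le> C\<^sup>2"
      using \<alpha>[of k] \<alpha>[of l] by (auto simp: power2_eq_square intro!: mult_mono)
    show "\<alpha> k j * \<alpha> l j * K (x k) (x l) \<le> (C - \<pi> k l)\<^sup>2 * K (x k) (x l)"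
    proof (cases "K (x k) (x l) < 0")
      case True
      then show ?thesis using prod by (simp add: \<pi>_def mult_nonneg_nonpos)
    next
      case False
      then show ?thesis using prod by (simp add: \<pi>_def mult_right_mono)
    qed
  qed
  ultimately show ?thesis by (simp add: kernel_dist_def kernel_big_M_def Let_def \<pi>_def)
qed

text \<open>
  The kernel expression is a squared distance, hence nonnegative. So if R is negative, the
  errors of the observations of that hypersphere are at least its absolute value and can absorb it;
  as their total cost coefficient is at least 1, the objective does not increase. The constraint
  for the other observations is then implied by the bound on the kernel expression.
\<close>

lemma K_large_enough_kernel_big_M:
  fixes \<Phi> :: "real ^ 'd \<Rightarrow> real ^ 'e"
  assumes C: "0 < C" and K: "\<And>u v. K u v = \<Phi> u \<bullet> \<Phi> v"
  shows "K_large_enough n p C x K (kernel_big_M n C x K)"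
  unfolding K_large_enough_def
proof (rule antisym; rule msvdd_value_mono)
  fix s assume "s \<in> K_feasible n p C x K (kernel_big_M n C x K)"
  then show "\<exists>t\<in>K_feasible_cond n p C x K. msvdd_objective n p C t \<le> msvdd_objective n p C s"
    using K_feasible_subset_cond by blast
next
  fix s assume s: "s \<in> K_feasible_cond n p C x K"
  let ?N = "{1..n}" and ?P = "{1..p}"
  obtain R \<alpha> \<xi> z where [simp]: "s = (R, \<alpha>, \<xi>, z)" by (cases s) auto
  have dist: "\<And>i j. i \<in> ?N \<Longrightarrow> j \<in> ?P \<Longrightarrow> z i j = 1 \<Longrightarrow> kernel_dist n K x \<alpha> i j \<le> R j + \<xi> i"
    and \<alpha>: "\<forall>i\<in>?N. \<forall>j\<in>?P. 0 \<le> \<alpha> i j \<and> \<alpha> i j \<le> C * z i j" "\<forall>j\<in>?P. (\<Sum>i\<in>?N. \<alpha> i j) = 1"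
    and asg: "msvdd_assignment n p \<xi> z"
    using s by (auto simp: K_feasible_cond_def)
  have z: "z i j = 0 \<or> z i j = 1" if "i \<in> ?N" "j \<in> ?P" for i j
    using asg that by (auto simp: msvdd_assignment_def)
  have kd0: "0 \<le> kernel_dist n K x \<alpha> i j" for i j
    by (simp add: kernel_dist_eq_norm[of K \<Phi>, OF K])
  define neg where "neg j = min 0 (R j)" for j
  define R' where "R' j = R j - neg j" for j
  define \<xi>' where "\<xi>' i = \<xi> i + (\<Sum>j\<in>?P. z i j * neg j)" for i
  have \<xi>'_eq: "\<xi>' i = \<xi> i + neg j" if ij: "i \<in> ?N" "j \<in> ?P" and one: "z i j = 1" for i j
  proof -
    have "(\<Sum>j\<in>?P. z i j) = 1" using asg ij by (simp add: msvdd_assignment_def)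
    then have "(\<Sum>j'\<in>?P - {j}. z i j') = 0" using ij one by (simp add: sum_diff1)
    moreover have "0 \<le> z i j'" if "j' \<in> ?P" for j' using z[OF ij(1) that] by auto
    ultimately have "\<forall>j'\<in>?P - {j}. z i j' = 0" by (subst (asm) sum_nonneg_eq_0_iff) auto
    then have "(\<Sum>j'\<in>?P - {j}. z i j' * neg j') = 0" by (intro sum.neutral) auto
    moreover have "(\<Sum>j'\<in>?P. z i j' * neg j') = z i j * neg j + (\<Sum>j'\<in>?P - {j}. z i j' * neg j')"
      using ij by (intro sum.remove) auto
    ultimately show ?thesis using one by (simp add: \<xi>'_def)
  qed
  have \<xi>'0: "0 \<le> \<xi>' i" if i: "i \<in> ?N" for i
  proof -
    have "(\<Sum>j\<in>?P. z i j) = 1" using asg i by (simp add: msvdd_assignment_def)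
    then obtain j where j: "j \<in> ?P" "z i j \<noteq> 0" by (metis sum.neutral zero_neq_one)
    then have "z i j = 1" using z i by blast
    then have "0 \<le> R j + \<xi> i" "\<xi>' i = \<xi> i + neg j"
      using dist[OF i j(1)] kd0[of i j] \<xi>'_eq[OF i j(1)] by auto
    then show ?thesis using asg i by (auto simp: neg_def min_def msvdd_assignment_def)
  qed
  have "kernel_dist n K x \<alpha> i j \<le> R' j + \<xi>' i + kernel_big_M n C x K i * (1 - z i j)"
    if ij: "i \<in> ?N" "j \<in> ?P" for i j
  proof (cases "z i j = 1")
    case True
    then show ?thesis using dist[OF ij] \<xi>'_eq[OF ij] by (simp add: R'_def)
  next
    case False
    have "0 \<le> \<alpha> k j \<and> \<alpha> k j \<le> C" if "k \<in> ?N" for k using \<alpha>(1) C z[OF that ij(2)] ij that by force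
    then have "kernel_dist n K x \<alpha> i j \<le> kernel_big_M n C x K i"
      by (rule kernel_dist_le_kernel_big_M)
    moreover have "0 \<le> R' j" by (simp add: R'_def neg_def)
    ultimately show ?thesis using False z[OF ij] \<xi>'0[OF ij(1)] by auto
  qed
  then have t: "(R', \<alpha>, \<xi>', z) \<in> K_feasible n p C x K (kernel_big_M n C x K)"
    using \<alpha> asg \<xi>'0 by (auto simp: K_feasible_def msvdd_assignment_def)
  have "(\<Sum>i\<in>?N. C * (\<Sum>j\<in>?P. z i j * neg j)) = (\<Sum>j\<in>?P. \<Sum>i\<in>?N. C * z i j * neg j)"
    unfolding sum_distrib_left by (subst sum.swap) (simp add: mult_ac)
  also have "\<dots> = (\<Sum>j\<in>?P. (\<Sum>i\<in>?N. C * z i j) * neg j)"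
    by (simp add: sum_distrib_right)
  also have "\<dots> \<le> (\<Sum>j\<in>?P. 1 * neg j)"
    using capped_coefficients_mass[OF \<alpha>]
    by (intro sum_mono mult_right_mono_neg) (auto simp: neg_def)
  finally have "msvdd_objective n p C (R', \<alpha>, \<xi>', z) \<le> msvdd_objective n p C s"
    by (simp add: msvdd_objective_def R'_def \<xi>'_def distrib_left sum.distrib sum_subtractf)
  then show "\<exists>t\<in>K_feasible n p C x K (kernel_big_M n C x K).
      msvdd_objective n p C t \<le> msvdd_objective n p C s"
    using t by blast
qed

section \<open>Equivalence of the two problems\<close>

theorem theorem3p1:
  fixes n p :: nat and C :: real
    and x :: "nat \<Rightarrow> real ^ 'd"
    and \<Phi> :: "real ^ 'd \<Rightarrow> real ^ 'e"
    and K :: "real ^ 'd \<Rightarrow> real ^ 'd \<Rightarrow> real"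
  assumes "1 \<le> p" and "p < n" and "C > 0"
    and "\<And>u v. K u v = \<Phi> u \<bullet> \<Phi> v"
  shows
    "(\<forall>\<Delta> \<Delta>'. Phi_large_enough n p C x \<Phi> \<Delta> \<and> K_large_enough n p C x K \<Delta>' \<longrightarrow>
        msvdd_value n p C (Phi_feasible n p C x \<Phi> \<Delta>)
        = msvdd_value n p C (K_feasible n p C x K \<Delta>')) \<and>
     (\<forall>\<Delta>. K_large_enough n p C x K \<Delta> \<longrightarrow>
        msvdd_value n p C (Phi_feasible n p C x \<Phi> \<Delta>)
          = msvdd_value n p C (K_feasible n p C x K \<Delta>) \<and>
        (\<forall>R c \<xi> z. msvdd_optimal n p C (Phi_feasible n p C x \<Phi> \<Delta>) (R, c, \<xi>, z) \<longrightarrow>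
           (\<exists>\<alpha>. (\<forall>j\<in>{1..p}. c j = (\<Sum>i\<in>{1..n}. \<alpha> i j *\<^sub>R \<Phi> (x i))) \<and>
                msvdd_optimal n p C (K_feasible n p C x K \<Delta>) (R, \<alpha>, \<xi>, z))) \<and>
        (\<forall>R \<alpha> \<xi> z. msvdd_optimal n p C (K_feasible n p C x K \<Delta>) (R, \<alpha>, \<xi>, z) \<longrightarrow>
           msvdd_optimal n p C (Phi_feasible n p C x \<Phi> \<Delta>)
             (R, (\<lambda>j. \<Sum>i\<in>{1..n}. \<alpha> i j *\<^sub>R \<Phi> (x i)), \<xi>, z))) \<and>
     K_large_enough n p C x K (kernel_big_M n C x K)"
proof (intro conjI allI impI)
  fix \<Delta> \<Delta>'
  assume "Phi_large_enough n p C x \<Phi> \<Delta> \<and> K_large_enough n p C x K \<Delta>'"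
  then show "msvdd_value n p C (Phi_feasible n p C x \<Phi> \<Delta>)
      = msvdd_value n p C (K_feasible n p C x K \<Delta>')"
    using conditional_values_eq[where K = K, OF assms(3,4)]
    by (simp add: Phi_large_enough_def K_large_enough_def)
next
  fix \<Delta> assume large: "K_large_enough n p C x K \<Delta>"
  show "msvdd_value n p C (Phi_feasible n p C x \<Phi> \<Delta>)
      = msvdd_value n p C (K_feasible n p C x K \<Delta>)"
    by (rule Phi_value_eq_K_value[OF assms(3,4) large])
  fix R c \<xi> z assume "msvdd_optimal n p C (Phi_feasible n p C x \<Phi> \<Delta>) (R, c, \<xi>, z)"
  then show "\<exists>\<alpha>. (\<forall>j\<in>{1..p}. c j = (\<Sum>i\<in>{1..n}. \<alpha> i j *\<^sub>R \<Phi> (x i))) \<and>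
      msvdd_optimal n p C (K_feasible n p C x K \<Delta>) (R, \<alpha>, \<xi>, z)"
    by (rule optimal_K_from_optimal_Phi[OF assms(3,4) large])
next
  fix \<Delta> R \<alpha> \<xi> z
  assume "K_large_enough n p C x K \<Delta>"
    and "msvdd_optimal n p C (K_feasible n p C x K \<Delta>) (R, \<alpha>, \<xi>, z)"
  then show "msvdd_optimal n p C (Phi_feasible n p C x \<Phi> \<Delta>)
      (R, (\<lambda>j. \<Sum>i\<in>{1..n}. \<alpha> i j *\<^sub>R \<Phi> (x i)), \<xi>, z)"
    by (rule optimal_Phi_from_optimal_K[OF assms(3,4)])
next
  show "K_large_enough n p C x K (kernel_big_M n C x K)"
    by (rule K_large_enough_kernel_big_M[OF assms(3,4)])
qed

end
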